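(* Let $d\ge1$ and $s\in(1,2)$. There is a constant $C$ depending only on $d$ and $s$ such that the following holds. Let $u:\mathbb{R}^d\to\mathbb{R}$ be continuous and strictly convex at the point $x\in\mathbb{R}^d$. For $b\in\partial u(x)$ and $t>0$ let $$\mu_b(t)=|\{y\in\mathbb{R}^d:u(y)-u(x)-b\cdot(y-x)<t\}|.$$ Then $$\mathrm{MA}_su(x)=C\sup_{b\in\partial u(x)}\int_0^\infty\frac{1}{\mu_b(t)^{s/d}}\,dt .$$
   Context: $|\cdot|$ is Lebesgue measure, and $1/\mu_b(t)^{s/d}=0$ if $\mu_b(t)=+\infty$. $\partial u(x)=\{b\in\mathbb{R}^d:u(z)\ge u(x)+b\cdot(z-x)\ \forall z\in\mathbb{R}^d\}$. "$u$ is strictly convex at $x$" means that there is a supporting plane of $u$ (an affine function $\ell\le u$ on $\mathbb{R}^d$) that touches $u$ only at $x$. An admissible kernel is a measurable function $K:\mathbb{R}^d\to[0,\infty]$ such that $|\{y:K(y)>r^{-d-s}\}|=|B_r|$ for every $r>0$. Define $\mathrm{MA}_su(x)=-\infty$ if $\partial u(x)=\emptyset$, and otherwise $\mathrm{MA}_su(x)=\sup_{b\in\partial u(x)}\inf_{K\text{ admissible}}\int_{\mathbb{R}^d}(u(x+y)-u(x)-y\cdot b)K(y)\,dy\in[0,+\infty]$. *)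

theory Defs
  imports "HOL-Analysis.Analysis"
begin

definition subdiff :: "(real ^ 'n \<Rightarrow> real) \<Rightarrow> real ^ 'n \<Rightarrow> (real ^ 'n) set" where
  "subdiff u x = {b. \<forall>z. u z \<ge> u x + b \<bullet> (z - x)}"

definition strictly_convex_at :: "(real ^ 'n \<Rightarrow> real) \<Rightarrow> real ^ 'n \<Rightarrow> bool" where
  "strictly_convex_at u x \<longleftrightarrow>
     (\<exists>p c. (\<forall>z. p \<bullet> z + c \<le> u z) \<and> {z. u z = p \<bullet> z + c} = {x})"

definition admissible_kernel :: "real \<Rightarrow> (real ^ 'n \<Rightarrow> ennreal) \<Rightarrow> bool" where
  "admissible_kernel s K \<longleftrightarrow>
     K \<in> borel_measurable lebesgue \<and>
     (\<forall>r>0. emeasure lebesgue {y. K y > ennreal (r powr (- real CARD('n) - s))}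
            = emeasure lebesgue (ball (0 :: real ^ 'n) r))"

text \<open>
  For \<open>b \<in> subdiff u x\<close> the factor \<open>u (x + y) - u x - y \<bullet> b\<close> is nonnegative, so the
  embedding into \<^typ>\<open>ennreal\<close> truncates nothing.
\<close>

definition MA :: "real \<Rightarrow> (real ^ 'n \<Rightarrow> real) \<Rightarrow> real ^ 'n \<Rightarrow> ereal" where
  "MA s u x =
     (if subdiff u x = {} then - \<infinity>
      else enn2ereal
        (SUP b\<in>subdiff u x. INF K\<in>{K. admissible_kernel s K}.
           \<integral>\<^sup>+y. ennreal (u (x + y) - u x - y \<bullet> b) * K y \<partial>lebesgue))"

definition sublevel_measure ::
  "(real ^ 'n \<Rightarrow> real) \<Rightarrow> real ^ 'n \<Rightarrow> real ^ 'n \<Rightarrow> real \<Rightarrow> ennreal" where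
  "sublevel_measure u x b t = emeasure lebesgue {y. u y - u x - b \<bullet> (y - x) < t}"

text \<open>\<open>1 / m\<^sup>p\<close> for \<open>p > 0\<close> and \<open>m \<in> [0, \<infinity>]\<close>, with value \<open>0\<close> at \<open>m = \<infinity>\<close> (and \<open>\<infinity>\<close> at \<open>m = 0\<close>).\<close>

definition inverse_ennpowr :: "ennreal \<Rightarrow> real \<Rightarrow> ennreal" where
  "inverse_ennpowr m p = (if m = \<infinity> then 0 else 1 / ennreal (enn2real m powr p))"

end

theory Submission imports Defs begin

text \<open>
  For a fixed \<open>b\<close> put \<open>f y = u (x + y) - u x - y \<bullet> b \<ge> 0\<close>. By Tonelli, \<open>\<integral> f K\<close> is the integral over
  \<open>t > 0\<close> of the mass of \<open>K\<close> outside \<open>{f < t}\<close>. Among all admissible kernels that mass is smallest when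
  \<open>{f < t}\<close> is nested with the superlevel sets of \<open>K\<close>, and then it equals the tail beyond
  \<open>\<mu>\<^sub>b(t)\<close> of the profile \<open>(m / |B\<^sub>1|) powr (-1 - s / d)\<close>, that is \<open>C \<mu>\<^sub>b(t) powr (-s / d)\<close>.
  The bound is approached by kernels \<open>\<kappa> (rank y)\<close>, where \<open>rank y\<close> is the volume of the points that
  precede \<open>y\<close> when \<open>\<real>\<^sup>d\<close> is ordered lexicographically by \<open>f\<close>, rounded down to powers of some \<open>q > 1\<close>,
  and the norm; the rounding costs a factor \<open>q\<close>. If \<open>\<mu>\<^sub>b\<close> is infinite everywhere, kernels concentrated
  where \<open>f\<close> is small show that the infimum is \<open>0\<close>.
\<close>

section \<open>Layer-cake formulas\<close>

lemma sigma_finite_lebesgue: "sigma_finite_measure (lebesgue :: 'a::euclidean_space measure)"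
proof -
  obtain A :: "'a set set" where A: "countable A" "A \<subseteq> sets lborel" "\<Union>A = space lborel"
      "\<forall>a\<in>A. emeasure lborel a \<noteq> \<infinity>"
    using lborel.sigma_finite_countable by blast
  show ?thesis
    by standard (use A in \<open>auto intro!: exI[of _ A]\<close>)
qed

text \<open>Write \<open>f y\<close> as the length of \<open>{0<..f y}\<close> and exchange the
  integrals by Tonelli. A kernel then enters only through its mass outside the sublevel sets of
  \<open>f\<close>, which can be estimated for each \<open>t\<close> separately.\<close>

lemma nn_integral_layer_cake_weighted:
  fixes f :: "'a \<Rightarrow> real" and K :: "'a \<Rightarrow> ennreal"
  assumes M: "sigma_finite_measure M"
    and [measurable]: "f \<in> borel_measurable M" "K \<in> borel_measurable M"
    and f: "\<And>y. 0 \<le> f y"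
  shows "(\<integral>\<^sup>+y. ennreal (f y) * K y \<partial>M) =
    (\<integral>\<^sup>+t\<in>{0<..}. (\<integral>\<^sup>+y. K y * indicator {y. t \<le> f y} y \<partial>M) \<partial>lborel)"
proof -
  interpret M: sigma_finite_measure M by fact
  interpret pair_sigma_finite M lborel ..
  have eq: "ennreal (f y) * K y =
      (\<integral>\<^sup>+t. K y * indicator {y. t \<le> f y} y * indicator {0<..} t \<partial>lborel)" for y
  proof -
    have "(\<integral>\<^sup>+t. K y * indicator {y. t \<le> f y} y * indicator {0<..} t \<partial>lborel) =
        (\<integral>\<^sup>+t. K y * indicator {0<..f y} t \<partial>lborel)"
      by (intro nn_integral_cong) (auto split: split_indicator)
    also have "\<dots> = K y * ennreal (f y)"
      using f by (simp add: nn_integral_cmult_indicator)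
    finally show ?thesis by (simp add: mult.commute)
  qed
  have "(\<integral>\<^sup>+y. ennreal (f y) * K y \<partial>M) =
      (\<integral>\<^sup>+t. (\<integral>\<^sup>+y. K y * indicator {y. t \<le> f y} y * indicator {0<..} t \<partial>M) \<partial>lborel)"
    unfolding eq by (rule Fubini'[symmetric]) measurable
  also have "\<dots> = (\<integral>\<^sup>+t\<in>{0<..}. (\<integral>\<^sup>+y. K y * indicator {y. t \<le> f y} y \<partial>M) \<partial>lborel)"
    by (intro nn_integral_cong nn_integral_multc) measurable
  finally show ?thesis .
qed

text \<open>Kernels may take the value \<open>\<infinity>\<close>, so the case
  \<open>c = \<infinity>\<close> matters: there the half-line is exhausted by the intervals
  \<open>{0<..<real n}\<close>.\<close>

lemma emeasure_lborel_less_ennreal: "emeasure lborel {l. 0 < l \<and> ennreal l < c} = c"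
proof (cases c)
  case (real r)
  then have "{l. 0 < l \<and> ennreal l < c} = {0<..<r}"
    by (auto simp: ennreal_less_iff)
  then show ?thesis using real by simp
next
  case top
  have "(SUP n. emeasure lborel {0<..<real n}) = emeasure lborel (\<Union>n. {0<..<real n})"
    by (rule SUP_emeasure_incseq) (auto simp: incseq_def)
  moreover have "(\<Union>n. {0<..<real n}) = {0<..}"
    by (auto simp: reals_Archimedean2)
  ultimately have "emeasure lborel {0::real<..} = (SUP n. of_nat n)"
    by (simp add: ennreal_of_nat_eq_real_of_nat)
  then show ?thesis
    using top by (simp add: greaterThan_def ennreal_SUP_of_nat_eq_top)
qed

lemma nn_integral_layer_cake:
  fixes X :: "'a \<Rightarrow> ennreal"
  assumes M: "sigma_finite_measure M" and [measurable]: "X \<in> borel_measurable M"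
  shows "(\<integral>\<^sup>+y. X y \<partial>M) = (\<integral>\<^sup>+l\<in>{0<..}. emeasure M {y\<in>space M. ennreal l < X y} \<partial>lborel)"
proof -
  interpret M: sigma_finite_measure M by fact
  interpret pair_sigma_finite M lborel ..
  have eq: "X y = (\<integral>\<^sup>+l. indicator {y. ennreal l < X y} y * indicator {0<..} l \<partial>lborel)" for y
  proof -
    have "(\<integral>\<^sup>+l. indicator {y. ennreal l < X y} y * indicator {0<..} l \<partial>lborel) =
        (\<integral>\<^sup>+l. indicator {l. 0 < l \<and> ennreal l < X y} l \<partial>lborel)"
      by (intro nn_integral_cong) (auto split: split_indicator)
    then show ?thesis
      by (simp add: emeasure_lborel_less_ennreal)
  qed
  have "(\<integral>\<^sup>+y. X y \<partial>M) =
      (\<integral>\<^sup>+l. (\<integral>\<^sup>+y. indicator {y. ennreal l < X y} y * indicator {0<..} l \<partial>M) \<partial>lborel)"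
    by (subst eq, rule Fubini'[symmetric]) measurable
  also have "\<dots> = (\<integral>\<^sup>+l\<in>{0<..}. emeasure M {y\<in>space M. ennreal l < X y} \<partial>lborel)"
  proof (intro nn_integral_cong)
    fix l :: real
    have "(\<integral>\<^sup>+y. indicator {y. ennreal l < X y} y * indicator {0<..} l \<partial>M) =
        (\<integral>\<^sup>+y. indicator {y\<in>space M. ennreal l < X y} y * indicator {0<..} l \<partial>M)"
      by (intro nn_integral_cong) (auto split: split_indicator)
    also have "\<dots> = emeasure M {y\<in>space M. ennreal l < X y} * indicator {0<..} l"
      by (subst nn_integral_multc) auto
    finally show "(\<integral>\<^sup>+y. indicator {y. ennreal l < X y} y * indicator {0<..} l \<partial>M) =
        emeasure M {y\<in>space M. ennreal l < X y} * indicator {0<..} l" .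
  qed
  finally show ?thesis .
qed

text \<open>By the layer-cake formula an integral depends only on the measures of superlevel sets,
  so functions on different spaces can be compared. Below, one side lives on
  \<open>real ^ 'n\<close> (a kernel) and the other on the half-line (its profile).\<close>

lemma nn_integral_mono_superlevel:
  fixes X :: "'a \<Rightarrow> ennreal" and Y :: "'b \<Rightarrow> ennreal"
  assumes "sigma_finite_measure M" "X \<in> borel_measurable M"
    and "sigma_finite_measure N" "Y \<in> borel_measurable N"
    and "\<And>l. 0 < l \<Longrightarrow>
      emeasure M {y\<in>space M. ennreal l < X y} \<le> emeasure N {y\<in>space N. ennreal l < Y y}"
  shows "(\<integral>\<^sup>+y. X y \<partial>M) \<le> (\<integral>\<^sup>+y. Y y \<partial>N)"
  unfolding nn_integral_layer_cake[OF assms(1,2)] nn_integral_layer_cake[OF assms(3,4)]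
  by (intro nn_integral_mono) (auto split: split_indicator intro: assms(5))

section \<open>Cutting a set to a prescribed volume by centred balls\<close>

text \<open>The volume of \<open>D \<inter> ball 0 r\<close> grows continuously with
  \<open>r\<close> because spheres are null. So it equals \<open>c\<close> at some radius, unless it
  stays below \<open>c\<close> forever, and then \<open>D\<close> itself has volume
  \<open>c\<close>.\<close>

lemma emeasure_initial_part:
  fixes D :: "'a::euclidean_space set"
  assumes [measurable]: "D \<in> sets borel" and c: "c \<le> emeasure lborel D" and fin: "c < \<infinity>"
  shows "emeasure lborel {y\<in>D. emeasure lborel (D \<inter> ball 0 (norm y)) < c} = c"
proof -
  define \<phi> where "\<phi> r = emeasure lborel (D \<inter> ball 0 r)" for r
  have \<phi>_mono: "\<phi> r \<le> \<phi> r'" if "r \<le> r'" for r r'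
    unfolding \<phi>_def using that by (intro emeasure_mono) auto
  define S where "S = {r. \<phi> r < c}"
  consider (zero) "c = 0" | (unbounded) "c \<noteq> 0" "\<not> bdd_above S" | (bounded) "c \<noteq> 0" "bdd_above S"
    by blast
  then show ?thesis
  proof cases
    case zero
    then show ?thesis by simp
  next
    case unbounded
    have S: "\<phi> r < c" for r
    proof -
      obtain r' where "r' \<in> S" "r < r'"
        using unbounded(2) unfolding bdd_above_def by (meson not_le)
      then show ?thesis
        using \<phi>_mono[of r r'] by (auto simp: S_def)
    qed
    have "(SUP n. \<phi> (real n)) = emeasure lborel (\<Union>n. D \<inter> ball 0 (real n))"
      unfolding \<phi>_def by (rule SUP_emeasure_incseq) (auto simp: incseq_def)
    moreover have "(\<Union>n. D \<inter> ball 0 (real n)) = D"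
      by (auto simp: reals_Archimedean2)
    moreover have "(SUP n. \<phi> (real n)) \<le> c"
      by (intro SUP_least less_imp_le S)
    ultimately have "emeasure lborel D = c"
      using c by simp
    then show ?thesis
      using S by (simp add: \<phi>_def)
  next
    case bounded
    have "0 \<in> S"
      using bounded(1) by (simp add: S_def \<phi>_def zero_less_iff_neq_zero)
    define R where "R = Sup S"
    have below: "\<phi> r < c" if "r < R" for r
    proof -
      obtain r' where "r' \<in> S" "r < r'"
        using \<open>r < R\<close> less_cSup_iff[OF _ bounded(2), of r] \<open>0 \<in> S\<close> by (auto simp: R_def)
      then show ?thesis
        using \<phi>_mono[of r r'] by (auto simp: S_def)
    qed
    have above: "c \<le> \<phi> r" if "R < r" for r
    proof (rule ccontr)
      assume "\<not> c \<le> \<phi> r"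
      then have "r \<in> S" by (simp add: S_def)
      then show False
        using cSup_upper[OF _ bounded(2), of r] that by (simp add: R_def)
    qed
    \<comment> \<open>From below, the smaller balls exhaust \<open>ball 0 R\<close>, which gives
      \<open>\<phi> R \<le> c\<close>.\<close>
    have "(SUP n. \<phi> (R - 1 / Suc n)) = emeasure lborel (\<Union>n. D \<inter> ball 0 (R - 1 / Suc n))"
      unfolding \<phi>_def
    proof (rule SUP_emeasure_incseq)
      show "incseq (\<lambda>n. D \<inter> ball 0 (R - 1 / real (Suc n)))"
        unfolding incseq_def
        by (intro allI impI Int_mono order_refl subset_ball diff_left_mono divide_left_mono) auto
    qed auto
    moreover have "(\<Union>n. D \<inter> ball 0 (R - 1 / Suc n)) = D \<inter> ball 0 R"
    proof -
      have "\<exists>n. norm y < R - 1 / Suc n" if "norm y < R" for y :: 'a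
        using reals_Archimedean[of "R - norm y"] that by (auto simp: inverse_eq_divide algebra_simps)
      moreover have "norm y < R" if "norm y < R - 1 / Suc n" for y :: 'a and n
        using that by (smt (verit) divide_pos_pos of_nat_0_less_iff zero_less_Suc)
      ultimately show ?thesis by auto
    qed
    moreover have "(SUP n. \<phi> (R - 1 / Suc n)) \<le> c"
      by (intro SUP_least less_imp_le below) auto
    ultimately have le: "\<phi> R \<le> c"
      by (simp add: \<phi>_def)
    have finball: "emeasure lborel (D \<inter> ball 0 r) < \<infinity>" for r
      using emeasure_mono[of "D \<inter> ball 0 r" "ball 0 r" lborel] emeasure_lborel_ball_finite[of 0 r]
      by (auto simp: less_top[symmetric] top_unique)
    \<comment> \<open>From above, the larger balls shrink to the closed ball, which adds only a null
      sphere; this gives \<open>c \<le> \<phi> R\<close>.\<close>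
    have "(INF n. \<phi> (R + 1 / Suc n)) = emeasure lborel (\<Inter>n. D \<inter> ball 0 (R + 1 / Suc n))"
      unfolding \<phi>_def
    proof (rule INF_emeasure_decseq)
      show "decseq (\<lambda>n. D \<inter> ball 0 (R + 1 / real (Suc n)))"
        unfolding decseq_def
        by (intro allI impI Int_mono order_refl subset_ball add_left_mono divide_left_mono) auto
    qed (use finball in \<open>auto simp: less_top\<close>)
    moreover have "(\<Inter>n. D \<inter> ball 0 (R + 1 / Suc n)) \<subseteq> (D \<inter> ball 0 R) \<union> sphere 0 R"
    proof -
      have "norm y \<le> R" if "\<forall>n. norm y < R + 1 / Suc n" for y :: 'a
      proof (rule ccontr)
        assume "\<not> norm y \<le> R"
        then obtain n where "inverse (real (Suc n)) < norm y - R"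
          using reals_Archimedean[of "norm y - R"] by auto
        with that show False by (auto simp: inverse_eq_divide) (smt (verit))
      qed
      then show ?thesis by (fastforce simp: order_le_less)
    qed
    then have "emeasure lborel (\<Inter>n. D \<inter> ball 0 (R + 1 / Suc n)) \<le>
        emeasure lborel ((D \<inter> ball 0 R) \<union> sphere 0 R)"
      by (intro emeasure_mono) auto
    moreover have "emeasure lborel ((D \<inter> ball 0 R) \<union> sphere 0 R) = \<phi> R"
    proof -
      have "sphere (0::'a) R \<in> null_sets lborel"
        using negligible_sphere[of "0::'a" R]
        by (auto simp: null_sets_completion_iff negligible_iff_null_sets)
      then show ?thesis
        unfolding \<phi>_def by (intro emeasure_Un_null_set) auto
    qed
    moreover have "c \<le> (INF n. \<phi> (R + 1 / Suc n))"
      by (intro INF_greatest above) auto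
    ultimately have eq: "\<phi> R = c"
      using le by (auto intro: antisym)
    have "{y\<in>D. \<phi> (norm y) < c} = D \<inter> ball 0 R"
      using below \<phi>_mono[of R] eq by (auto simp: not_le[symmetric])
    then show ?thesis
      using eq by (simp add: \<phi>_def)
  qed
qed

section \<open>The extremal profile as a function of volume\<close>

lemma inverse_ennpowr_ennreal:
  "0 < r \<Longrightarrow> inverse_ennpowr (ennreal r) p = ennreal (r powr (- p))"
  by (simp add: inverse_ennpowr_def powr_minus divide_ennreal_def inverse_ennreal)

lemma inverse_ennpowr_top [simp]: "inverse_ennpowr top p = 0"
  by (simp add: inverse_ennpowr_def)

lemma inverse_ennpowr_0 [simp]: "inverse_ennpowr 0 p = top"
  by (simp add: inverse_ennpowr_def ennreal_divide_zero)

lemma borel_measurable_inverse_ennpowr [measurable]: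
  "(\<lambda>m. inverse_ennpowr m p) \<in> borel_measurable borel"
  unfolding inverse_ennpowr_def by measurable

lemma inverse_ennpowr_antimono:
  assumes "0 < p" "a \<le> b"
  shows "inverse_ennpowr b p \<le> inverse_ennpowr a p"
proof (cases "a = 0 \<or> b = \<infinity>")
  case False
  then obtain x y where "a = ennreal x" "b = ennreal y" "0 < x" "0 < y" "x \<le> y"
    using \<open>a \<le> b\<close> by (cases a; cases b) (auto simp: less_le top_unique)
  then show ?thesis
    using \<open>0 < p\<close> by (auto simp: inverse_ennpowr_ennreal intro!: ennreal_leI powr_mono2')
qed auto

text \<open>Inverting the decreasing power turns superlevel sets of the profile into sublevel sets
  of volume. The default values at \<open>0\<close> and \<open>\<infinity>\<close> are the ones that
  keep the equivalence true there.\<close>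

lemma less_inverse_ennpowr_iff:
  assumes "0 < l" "0 < c" "0 < p"
  shows "ennreal l < ennreal c * inverse_ennpowr m p \<longleftrightarrow> m < ennreal ((c / l) powr (1 / p))"
proof (cases m)
  case (real r)
  show ?thesis
  proof (cases "r = 0")
    case True
    then show ?thesis
      using assms real by (simp add: ennreal_mult_top)
  next
    case False
    then have "0 < r" using real by simp
    have "ennreal l < ennreal c * inverse_ennpowr m p \<longleftrightarrow> l < c * r powr (- p)"
      using \<open>0 < r\<close> assms real
      by (simp add: inverse_ennpowr_ennreal ennreal_mult[symmetric] ennreal_less_iff)
    also have "\<dots> \<longleftrightarrow> r powr p < c / l"
      using \<open>0 < r\<close> assms by (simp add: powr_minus field_simps)
    also have "\<dots> \<longleftrightarrow> (r powr p) powr (1 / p) < (c / l) powr (1 / p)"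
      using assms powr_less_mono2[of "1 / p" "r powr p" "c / l"]
        powr_less_cancel2[of "1 / p" "r powr p" "c / l"] \<open>0 < r\<close> by fastforce
    also have "\<dots> \<longleftrightarrow> m < ennreal ((c / l) powr (1 / p))"
      using assms real \<open>0 < r\<close> by (simp add: powr_powr ennreal_less_iff)
    finally show ?thesis .
  qed
qed (use assms in \<open>simp add: top_unique\<close>)

text \<open>The profile as a function of volume: a kernel is admissible iff it is equimeasurable with
  \<open>kernel_profile d s\<close> on \<open>(0, \<infinity>)\<close>.\<close>

definition kernel_profile :: "real \<Rightarrow> real \<Rightarrow> ennreal \<Rightarrow> ennreal" where
  "kernel_profile d s m = ennreal (unit_ball_vol d powr (1 + s / d)) * inverse_ennpowr m (1 + s / d)"

text \<open>The factor \<open>d / s\<close> comes from integrating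
  \<open>m powr (-1 - s / d)\<close> over a tail; the power of the unit ball volume is the
  normalisation of \<open>kernel_profile\<close>.\<close>

definition MA_constant :: "real \<Rightarrow> real \<Rightarrow> real" where
  "MA_constant d s = unit_ball_vol d powr (1 + s / d) * (d / s)"

lemma borel_measurable_kernel_profile [measurable]:
  "kernel_profile d s \<in> borel_measurable borel"
  unfolding kernel_profile_def by measurable

lemma MA_constant_pos: "0 < d \<Longrightarrow> 0 < s \<Longrightarrow> 0 < MA_constant d s"
  using unit_ball_vol_pos[of d] unfolding MA_constant_def
  by (intro mult_pos_pos divide_pos_pos) (auto simp: less_le)

text \<open>The profile is decreasing and takes the value \<open>r powr (- d - s)\<close> exactly at
  the volume of a ball of radius \<open>r\<close>.\<close>

lemma less_kernel_profile_iff: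
  assumes "0 < d" "0 < s" "0 < r"
  shows "ennreal (r powr (- d - s)) < kernel_profile d s m \<longleftrightarrow> m < ennreal (unit_ball_vol d * r powr d)"
proof -
  define w where "w = unit_ball_vol d"
  define p where "p = 1 + s / d"
  have w: "0 < w"
    using assms by (auto simp: w_def unit_ball_vol_pos)
  have p: "0 < p" "- d - s = - (d * p)"
    using assms by (auto simp: p_def add_pos_pos field_simps)
  have "w powr p / r powr (- d - s) = (w * r powr d) powr p"
    using assms w unfolding p(2) by (simp add: powr_mult powr_powr powr_minus divide_inverse)
  then have "(w powr p / r powr (- d - s)) powr (1 / p) = w * r powr d"
    using assms w p(1) by (simp add: powr_powr)
  then show ?thesis
    using less_inverse_ennpowr_iff[of "r powr (- d - s)" "w powr p" p m] assms w p(1)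
    by (simp add: kernel_profile_def w_def[symmetric] p_def[symmetric])
qed

lemma nn_integral_inverse_ennpowr_tail:
  assumes "0 < q" "0 < \<mu>"
  shows "(\<integral>\<^sup>+m\<in>{0<..}. inverse_ennpowr (ennreal m) (1 + q) * indicator {m. \<mu> \<le> ennreal m} m \<partial>lborel) =
    ennreal (1 / q) * inverse_ennpowr \<mu> q"
proof (cases \<mu>)
  case (real r)
  then have "0 < r" using assms by simp
  have "((\<lambda>x. x powr (- q)) \<longlongrightarrow> 0) at_top"
    using assms by (intro tendsto_neg_powr filterlim_ident) auto
  from tendsto_mult_left[OF this, of "- 1 / q"]
  have lim: "((\<lambda>x. - (x powr (- q)) / q) \<longlongrightarrow> 0) at_top" by simp
  have "(\<integral>\<^sup>+m\<in>{0<..}. inverse_ennpowr (ennreal m) (1 + q) * indicator {m. \<mu> \<le> ennreal m} m \<partial>lborel) =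
      (\<integral>\<^sup>+m. ennreal (m powr (- 1 - q)) * indicator {r..} m \<partial>lborel)"
    using real \<open>0 < r\<close>
    by (intro nn_integral_cong) (auto simp: inverse_ennpowr_ennreal split: split_indicator)
  also have "\<dots> = ennreal (0 - (- (r powr (- q)) / q))"
  proof (rule nn_integral_FTC_atLeast[OF _ _ _ lim])
    fix x assume "r \<le> x"
    then show "DERIV (\<lambda>x. - (x powr (- q)) / q) x :> x powr (- 1 - q)"
      using \<open>0 < r\<close> assms
      by (auto intro!: derivative_eq_intros simp: powr_diff powr_minus field_simps)
  qed auto
  also have "\<dots> = ennreal (1 / q) * inverse_ennpowr \<mu> q"
    using real \<open>0 < r\<close> assms by (simp add: inverse_ennpowr_ennreal ennreal_mult[symmetric])
  finally show ?thesis .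
qed (simp add: top_unique indicator_def)

lemma nn_integral_kernel_profile_tail:
  assumes "0 < d" "0 < s" "0 < \<mu>"
  shows "(\<integral>\<^sup>+m\<in>{0<..}. kernel_profile d s (ennreal m) * indicator {m. \<mu> \<le> ennreal m} m \<partial>lborel) =
    ennreal (MA_constant d s) * inverse_ennpowr \<mu> (s / d)"
proof -
  have "(\<integral>\<^sup>+m\<in>{0<..}. kernel_profile d s (ennreal m) * indicator {m. \<mu> \<le> ennreal m} m \<partial>lborel) =
    ennreal (unit_ball_vol d powr (1 + s / d)) *
    (\<integral>\<^sup>+m\<in>{0<..}. inverse_ennpowr (ennreal m) (1 + s / d) * indicator {m. \<mu> \<le> ennreal m} m \<partial>lborel)"
    by (subst nn_integral_cmult[symmetric]) (auto simp: kernel_profile_def mult.assoc)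
  also have "\<dots> = ennreal (unit_ball_vol d powr (1 + s / d)) *
      (ennreal (1 / (s / d)) * inverse_ennpowr \<mu> (s / d))"
    using assms by (subst nn_integral_inverse_ennpowr_tail) auto
  also have "\<dots> = ennreal (MA_constant d s) * inverse_ennpowr \<mu> (s / d)"
    using assms by (simp add: MA_constant_def ennreal_mult[symmetric] mult.assoc[symmetric])
  finally show ?thesis .
qed

text \<open>The superlevel set is an interval from \<open>\<mu>\<close> to the volume of a ball;
  truncated subtraction covers the case in which it is empty. The lower and the upper bound for
  kernels are both compared with this number.\<close>

lemma emeasure_kernel_profile_tail_superlevel:
  assumes "0 < d" "0 < s" "0 < r"
  shows "emeasure lborel {m. ennreal (r powr (- d - s)) <
      kernel_profile d s (ennreal m) * indicator {m. \<mu> \<le> ennreal m} m * indicator {0<..} m} =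
    ennreal (unit_ball_vol d * r powr d) - \<mu>"
proof -
  define v where "v = unit_ball_vol d * r powr d"
  have "0 < v"
    using assms unit_ball_vol_pos[of d] by (simp add: v_def)
  have "{m. ennreal (r powr (- d - s)) <
      kernel_profile d s (ennreal m) * indicator {m. \<mu> \<le> ennreal m} m * indicator {0<..} m} =
      {m. 0 < m \<and> \<mu> \<le> ennreal m \<and> m < v}"
    using less_kernel_profile_iff[OF assms] 
    by (auto simp: v_def[symmetric] ennreal_less_iff split: split_indicator_asm split_indicator)
  also have "emeasure lborel \<dots> = ennreal v - \<mu>"
  proof (cases \<mu>)
    case (real a)
    show ?thesis
    proof (cases "a \<le> v")
      case True
      \<comment> \<open>The set contains positive \<open>m\<close> only, hence the open interval
        when \<open>a = 0\<close>.\<close>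
      have "{m. 0 < m \<and> \<mu> \<le> ennreal m \<and> m < v} = (if a = 0 then {0<..<v} else {a..<v})"
        using real by auto
      then show ?thesis
        using real True \<open>0 < v\<close> by (simp add: ennreal_minus)
    next
      case False
      then have "{m. 0 < m \<and> \<mu> \<le> ennreal m \<and> m < v} = {}"
        using real by auto
      then show ?thesis
        using real False \<open>0 < v\<close> by (simp only:) (simp add: ennreal_minus ennreal_neg)
    qed
  qed (simp add: top_unique)
  finally show ?thesis by (simp add: v_def)
qed

text \<open>Admissibility mentions only the levels \<open>r powr (- d - s)\<close>. These are all
  the positive numbers, so it fixes the measure of every superlevel set.\<close>

lemma ex_powr_eq:
  assumes "0 < l" "0 < (a::real)"
  obtains r where "0 < r" "l = r powr (- a)"
proof
  show "0 < l powr (- 1 / a)" "l = (l powr (- 1 / a)) powr (- a)"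
    using assms by (simp_all add: powr_powr)
qed

section \<open>Lower bound for every admissible kernel\<close>

text \<open>Bathtub principle: at the level belonging to radius \<open>r\<close>, the superlevel set
  of \<open>K\<close> has the volume of \<open>ball 0 r\<close> and loses at most the volume of
  \<open>- E\<close> when restricted to \<open>E\<close>. What is left is at least the superlevel
  measure of the profile cut off at the volume of \<open>- E\<close>, whose integral is
  explicit.\<close>

lemma admissible_kernel_nn_integral_ge:
  fixes K :: "real ^ 'n \<Rightarrow> ennreal"
  assumes s: "0 < s" and K: "admissible_kernel s K" and E [measurable]: "E \<in> sets lebesgue"
    and pos: "0 < emeasure lebesgue (- E)"
  shows "ennreal (MA_constant (real CARD('n)) s) *
      inverse_ennpowr (emeasure lebesgue (- E)) (s / real CARD('n)) \<le>
    (\<integral>\<^sup>+y. K y * indicator E y \<partial>lebesgue)"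
proof -
  define d where "d = real CARD('n)"
  have d: "0 < d" by (simp add: d_def)
  note [measurable] = K[unfolded admissible_kernel_def, THEN conjunct1]
  have "(\<integral>\<^sup>+m\<in>{0<..}. kernel_profile d s (ennreal m) *
        indicator {m. emeasure lebesgue (- E) \<le> ennreal m} m \<partial>lborel) \<le>
      (\<integral>\<^sup>+y. K y * indicator E y \<partial>lebesgue)"
  proof (rule nn_integral_mono_superlevel[OF sigma_finite_lborel _ sigma_finite_lebesgue])
    fix l :: real assume "0 < l"
    then obtain r where r: "0 < r" "l = r powr (- d - s)"
      using ex_powr_eq[of l "d + s"] s d by auto
    have "{y \<in> space lebesgue. ennreal l < K y} \<in> sets lebesgue"
      by measurable
    then have [measurable]: "{y. ennreal l < K y} \<in> sets lebesgue"
      by simp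
    have [measurable]: "- E \<in> sets lebesgue"
      using E by (simp add: Compl_in_sets_lebesgue)
    have "ennreal (unit_ball_vol d * r powr d) = emeasure lebesgue (ball (0::real^'n) r)"
      using r(1) by (simp add: d_def emeasure_ball powr_realpow)
    also have "\<dots> = emeasure lebesgue {y. ennreal l < K y}"
      unfolding r(2) d_def
      by (rule K[unfolded admissible_kernel_def, THEN conjunct2, rule_format, OF r(1), symmetric])
    also have "\<dots> \<le> emeasure lebesgue ({y. ennreal l < K y} \<inter> E \<union> - E)"
      by (intro emeasure_mono) auto
    also have "\<dots> \<le> emeasure lebesgue ({y. ennreal l < K y} \<inter> E) + emeasure lebesgue (- E)"
      by (intro emeasure_subadditive) auto
    also have "{y. ennreal l < K y} \<inter> E = {y. ennreal l < K y * indicator E y}"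
      by (auto split: split_indicator_asm split_indicator)
    finally have "ennreal (unit_ball_vol d * r powr d) - emeasure lebesgue (- E) \<le>
        emeasure lebesgue {y. ennreal l < K y * indicator E y}"
      by (simp add: ennreal_minus_le_iff add.commute)
    then show "emeasure lborel {m \<in> space lborel. ennreal l <
          kernel_profile d s (ennreal m) * indicator {m. emeasure lebesgue (- E) \<le> ennreal m} m *
          indicator {0<..} m}
        \<le> emeasure lebesgue {y \<in> space lebesgue. ennreal l < K y * indicator E y}"
      by (simp only: r(2) emeasure_kernel_profile_tail_superlevel[OF d s r(1)]
          space_lborel space_completion space_borel UNIV_I simp_thms)
  qed auto
  then show ?thesis
    unfolding nn_integral_kernel_profile_tail[OF d s pos] by (simp only: d_def)
qed

lemma borel_measurable_sublevel_measure:
  fixes f :: "'a::euclidean_space \<Rightarrow> real"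
  assumes [measurable]: "f \<in> borel_measurable borel"
  shows "(\<lambda>t. emeasure lborel {y. f y < t}) \<in> borel_measurable borel"
proof -
  have "{p \<in> space (borel \<Otimes>\<^sub>M lborel). f (snd p) < fst p} \<in> sets (borel \<Otimes>\<^sub>M lborel)"
    by measurable
  from lborel.measurable_emeasure_Pair[OF this] show ?thesis
    by (simp add: vimage_def space_pair_measure)
qed

lemma admissible_kernel_lower_bound:
  fixes K :: "real ^ 'n \<Rightarrow> ennreal"
  assumes s: "0 < s" and K: "admissible_kernel s K" and f: "continuous_on UNIV f"
    and nonneg: "\<And>y. 0 \<le> f y" and zero: "f 0 = 0"
  shows "ennreal (MA_constant (real CARD('n)) s) *
      (\<integral>\<^sup>+t\<in>{0<..}. inverse_ennpowr (emeasure lebesgue {y. f y < t}) (s / real CARD('n)) \<partial>lborel) \<le>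
    (\<integral>\<^sup>+y. ennreal (f y) * K y \<partial>lebesgue)"
proof -
  have fb [measurable]: "f \<in> borel_measurable borel"
    using f by (rule borel_measurable_continuous_onI)
  have fl [measurable]: "f \<in> borel_measurable lebesgue"
    using fb by (simp add: measurable_completion)
  note [measurable] = K[unfolded admissible_kernel_def, THEN conjunct1]
  have mes: "(\<lambda>t. emeasure lebesgue {y. f y < t}) \<in> borel_measurable borel"
    using borel_measurable_sublevel_measure[OF fb] by simp
  have "ennreal (MA_constant (real CARD('n)) s) *
      (\<integral>\<^sup>+t\<in>{0<..}. inverse_ennpowr (emeasure lebesgue {y. f y < t}) (s / real CARD('n)) \<partial>lborel) =
    (\<integral>\<^sup>+t\<in>{0<..}. ennreal (MA_constant (real CARD('n)) s) *
      inverse_ennpowr (emeasure lebesgue {y. f y < t}) (s / real CARD('n)) \<partial>lborel)"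
    using mes by (subst nn_integral_cmult[symmetric]) (auto simp: mult.assoc)
  also have "\<dots> \<le> (\<integral>\<^sup>+t\<in>{0<..}. (\<integral>\<^sup>+y. K y * indicator {y. t \<le> f y} y \<partial>lebesgue) \<partial>lborel)"
  proof (intro nn_integral_mono)
    fix t :: real
    have "ennreal (MA_constant (real CARD('n)) s) *
        inverse_ennpowr (emeasure lebesgue {y. f y < t}) (s / real CARD('n)) \<le>
        (\<integral>\<^sup>+y. K y * indicator {y. t \<le> f y} y \<partial>lebesgue)" if "0 < t"
    proof -
      have eq: "- {y. t \<le> f y} = {y. f y < t}" by auto
      \<comment> \<open>Being open and containing \<open>0\<close>, the sublevel set has positive
        measure, as the bathtub bound requires.\<close>
      have "open {y. f y < t}"
        by (rule open_Collect_less[OF f continuous_on_const])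
      moreover have fmeas: "{y. f y < t} \<in> sets lebesgue"
        using borel_measurable_less[OF fl, of "\<lambda>_. t"] by simp
      moreover have "{y. f y < t} \<noteq> {}"
        using zero that by (auto intro!: exI[of _ 0])
      ultimately have "0 < emeasure lebesgue {y. f y < t}"
        using open_not_negligible[of "{y. f y < t}"]
        by (simp only: negligible_iff_emeasure0[OF fmeas] zero_less_iff_neq_zero not_False_eq_True)
      then show ?thesis
        using admissible_kernel_nn_integral_ge[OF s K, of "{y. t \<le> f y}"] by (simp add: eq)
    qed
    then show "ennreal (MA_constant (real CARD('n)) s) *
        inverse_ennpowr (emeasure lebesgue {y. f y < t}) (s / real CARD('n)) * indicator {0<..} t \<le>
        (\<integral>\<^sup>+y. K y * indicator {y. t \<le> f y} y \<partial>lebesgue) * indicator {0<..} t"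
      by (auto split: split_indicator)
  qed
  also have "\<dots> = (\<integral>\<^sup>+y. ennreal (f y) * K y \<partial>lebesgue)"
    by (rule nn_integral_layer_cake_weighted[symmetric, OF sigma_finite_lebesgue]) (auto simp: nonneg)
  finally show ?thesis .
qed

section \<open>Kernels built from a lexicographic rank\<close>

lemma sets_borel_initial_part:
  fixes D :: "'a::euclidean_space set"
  assumes [measurable]: "D \<in> sets borel"
  shows "{y\<in>D. emeasure lborel (D \<inter> ball 0 (norm y)) < c} \<in> sets borel"
proof -
  have "{p \<in> space (borel \<Otimes>\<^sub>M lborel). snd p \<in> D \<and> norm (snd p) < norm (fst p)} \<in>
      sets (borel \<Otimes>\<^sub>M lborel)" (is "?Q \<in> _")
    by measurable
  from lborel.measurable_emeasure_Pair[OF this]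
  have [measurable]: "(\<lambda>y. emeasure lborel (D \<inter> ball 0 (norm y))) \<in> borel_measurable borel"
    by (simp add: vimage_def space_pair_measure Int_def)
  show ?thesis by measurable
qed

text \<open>Ties are broken by the norm, whose level sets are null.\<close>

definition lex_rank :: "('a::euclidean_space \<Rightarrow> real) \<Rightarrow> 'a \<Rightarrow> ennreal" where
  "lex_rank g y = emeasure lborel {z. g z < g y \<or> g z = g y \<and> norm z < norm y}"

lemma borel_measurable_lex_rank:
  assumes [measurable]: "g \<in> borel_measurable borel"
  shows "lex_rank g \<in> borel_measurable borel"
proof -
  have "{p \<in> space (borel \<Otimes>\<^sub>M lborel). g (snd p) < g (fst p) \<or>
      g (snd p) = g (fst p) \<and> norm (snd p) < norm (fst p)} \<in> sets (borel \<Otimes>\<^sub>M lborel)"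
    by measurable
  from lborel.measurable_emeasure_Pair[OF this] show ?thesis
    by (simp add: vimage_def space_pair_measure lex_rank_def[abs_def])
qed

text \<open>Points below the level \<open>\<gamma>\<close> have rank less than \<open>a\<close>,
  points above it rank at least \<open>a\<close>. On the level set \<open>D\<close> the rank grows
  with the norm, and \<open>emeasure_initial_part\<close> shows that the points of rank below
  \<open>a\<close> there supply exactly the missing volume \<open>c\<close>.\<close>

lemma emeasure_lex_rank_less_of_level:
  fixes g :: "'a::euclidean_space \<Rightarrow> real"
  assumes g [measurable]: "g \<in> borel_measurable borel" and a: "a < \<infinity>"
    and \<gamma>: "emeasure lborel {y. g y < \<gamma>} < a" "a \<le> emeasure lborel {y. g y \<le> \<gamma>}"
  shows "emeasure lborel {y. lex_rank g y < a} = a"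
proof -
  define P where "P = {y. g y < \<gamma>}"
  define D where "D = {y. g y = \<gamma>}"
  have [measurable]: "P \<in> sets borel" "D \<in> sets borel"
    unfolding P_def D_def by measurable
  have PD: "P \<inter> D = {}" "{y. g y \<le> \<gamma>} = P \<union> D"
    by (auto simp: P_def D_def)
  define c where "c = a - emeasure lborel P"
  have Pfin: "emeasure lborel P < \<infinity>"
    using \<gamma>(1) a by (auto simp: P_def dest: less_trans)
  have ac: "a = emeasure lborel P + c"
    using \<gamma>(1) Pfin unfolding c_def
    by (simp add: P_def ennreal_add_diff_cancel_right add_diff_inverse_ennreal less_imp_le)
  have "emeasure lborel P + c \<le> emeasure lborel P + emeasure lborel D"
    using \<gamma>(2) PD ac by (simp add: plus_emeasure)
  then have cD: "c \<le> emeasure lborel D"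
    using Pfin by (auto simp: ennreal_add_left_cancel_le)
  have cfin: "c < \<infinity>"
    using a unfolding ac by (simp add: less_top[symmetric])
  define T where "T = {y\<in>D. emeasure lborel (D \<inter> ball 0 (norm y)) < c}"
  have T: "emeasure lborel T = c"
    unfolding T_def by (rule emeasure_initial_part) (use cD cfin in auto)
  have "{y. lex_rank g y < a} = P \<union> T"
  proof (intro set_eqI)
    fix y
    consider "g y < \<gamma>" | "g y = \<gamma>" | "\<gamma> < g y" by linarith
    then show "y \<in> {y. lex_rank g y < a} \<longleftrightarrow> y \<in> P \<union> T"
    proof cases
      case 1
      have "lex_rank g y \<le> emeasure lborel P"
        unfolding lex_rank_def using 1 by (intro emeasure_mono) (auto simp: P_def)
      then show ?thesis
        using 1 \<gamma>(1) by (auto simp: P_def)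
    next
      case 2
      have "{z. g z < g y \<or> g z = g y \<and> norm z < norm y} = P \<union> (D \<inter> ball 0 (norm y))"
        using 2 by (auto simp: P_def D_def)
      then have "lex_rank g y = emeasure lborel P + emeasure lborel (D \<inter> ball 0 (norm y))"
        unfolding lex_rank_def using PD by (subst plus_emeasure) auto
      then have iff: "lex_rank g y < a \<longleftrightarrow> emeasure lborel (D \<inter> ball 0 (norm y)) < c"
        using Pfin unfolding ac by (auto simp: ennreal_add_left_cancel_less)
      have "y \<in> D" "y \<notin> P"
        using 2 by (simp_all add: P_def D_def)
      then show ?thesis
        by (simp add: iff T_def)
    next
      case 3
      have "emeasure lborel {y. g y \<le> \<gamma>} \<le> lex_rank g y"
        unfolding lex_rank_def using 3 by (intro emeasure_mono) auto
      then show ?thesis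
        using 3 \<gamma>(2) by (auto simp: P_def D_def T_def)
    qed
  qed
  moreover have "emeasure lborel (P \<union> T) = a"
  proof -
    have [measurable]: "T \<in> sets borel"
      unfolding T_def by (intro sets_borel_initial_part) simp
    show ?thesis
      using PD(1) by (subst plus_emeasure[symmetric]) (auto simp: T ac, auto simp: T_def)
  qed
  ultimately show ?thesis by simp
qed

text \<open>This condition says that the rank does not jump over finite values; it can fail, since
  \<open>{g < \<gamma> + \<epsilon>}\<close> may have infinite measure for all \<open>\<epsilon> > 0\<close> while \<open>{g \<le> \<gamma>}\<close> has finite measure.\<close>

definition rankable :: "('a::euclidean_space \<Rightarrow> real) \<Rightarrow> bool" where
  "rankable g \<longleftrightarrow> g \<in> borel_measurable borel \<and>
    (\<forall>a. 0 < a \<longrightarrow> a < \<infinity> \<longrightarrow>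
      (\<exists>\<gamma>. emeasure lborel {y. g y < \<gamma>} < a \<and> a \<le> emeasure lborel {y. g y \<le> \<gamma>}))"

lemma emeasure_lex_rank_less:
  assumes "rankable g" "a < \<infinity>"
  shows "emeasure lborel {y. lex_rank g y < a} = a"
proof (cases "a = 0")
  case False
  then obtain \<gamma> where "emeasure lborel {y. g y < \<gamma>} < a" "a \<le> emeasure lborel {y. g y \<le> \<gamma>}"
    using assms by (auto simp: rankable_def zero_less_iff_neq_zero)
  then show ?thesis
    using assms by (intro emeasure_lex_rank_less_of_level) (auto simp: rankable_def)
qed simp

text \<open>By \<open>emeasure_lex_rank_less\<close> the rank is distributed like length on the
  half-line, so composing it with the profile gives the prescribed superlevel measures.\<close>

lemma admissible_kernel_lex_rank:
  fixes g :: "real ^ 'n \<Rightarrow> real"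
  assumes g: "rankable g" and s: "0 < s"
  shows "admissible_kernel s (\<lambda>y. kernel_profile (real CARD('n)) s (lex_rank g y))"
proof -
  have [measurable]: "lex_rank g \<in> borel_measurable borel"
    using g by (auto simp: rankable_def intro: borel_measurable_lex_rank)
  have K: "(\<lambda>y. kernel_profile (real CARD('n)) s (lex_rank g y)) \<in> borel_measurable borel"
    by measurable
  have "emeasure lebesgue {y. ennreal (r powr (- real CARD('n) - s)) <
      kernel_profile (real CARD('n)) s (lex_rank g y)} = emeasure lebesgue (ball (0::real^'n) r)"
    if "0 < r" for r
  proof -
    have "emeasure lebesgue {y. ennreal (r powr (- real CARD('n) - s)) <
        kernel_profile (real CARD('n)) s (lex_rank g y)} =
        emeasure lborel {y. lex_rank g y < ennreal (unit_ball_vol (real CARD('n)) * r powr real CARD('n))}"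
      using s that by (simp only: less_kernel_profile_iff of_nat_0_less_iff zero_less_card_finite) simp
    also have "\<dots> = emeasure lebesgue (ball (0::real^'n) r)"
      using that by (subst emeasure_lex_rank_less[OF g]) (auto simp: emeasure_ball powr_realpow)
    finally show ?thesis .
  qed
  then show ?thesis
    unfolding admissible_kernel_def using K by (simp add: measurable_completion)
qed

text \<open>The counterpart of the bathtub bound: superlevel sets of the kernel are initial segments
  of the rank, and \<open>E\<close> misses the first \<open>\<nu>\<close> of their volume. At most
  the superlevel measure of the profile cut off at \<open>\<nu>\<close> remains.\<close>

lemma nn_integral_lex_rank_kernel_le:
  fixes g :: "real ^ 'n \<Rightarrow> real"
  assumes g: "rankable g" and s: "0 < s" and E [measurable]: "E \<in> sets borel"
    and \<nu>: "\<And>y. y \<in> E \<Longrightarrow> \<nu> \<le> lex_rank g y"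
  shows "(\<integral>\<^sup>+y. kernel_profile (real CARD('n)) s (lex_rank g y) * indicator E y \<partial>lborel) \<le>
    ennreal (MA_constant (real CARD('n)) s) * inverse_ennpowr \<nu> (s / real CARD('n))"
proof (cases "\<nu> = 0")
  \<comment> \<open>Here the right-hand side is infinite.\<close>
  case True
  then show ?thesis
    using MA_constant_pos[of "real CARD('n)" s] s by (simp add: ennreal_mult_top)
next
  case False
  define d where "d = real CARD('n)"
  have d: "0 < d" by (simp add: d_def)
  have [measurable]: "lex_rank g \<in> borel_measurable borel"
    using g by (auto simp: rankable_def intro: borel_measurable_lex_rank)
  have "(\<integral>\<^sup>+y. kernel_profile d s (lex_rank g y) * indicator E y \<partial>lborel) \<le>
    (\<integral>\<^sup>+m\<in>{0<..}. kernel_profile d s (ennreal m) * indicator {m. \<nu> \<le> ennreal m} m \<partial>lborel)"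
  proof (rule nn_integral_mono_superlevel[OF sigma_finite_lborel _ sigma_finite_lborel])
    fix l :: real assume "0 < l"
    then obtain r where r: "0 < r" "l = r powr (- d - s)"
      using ex_powr_eq[of l "d + s"] s d by auto
    define v where "v = ennreal (unit_ball_vol d * r powr d)"
    have "{y. ennreal l < kernel_profile d s (lex_rank g y) * indicator E y} \<subseteq>
        {y. lex_rank g y < v} - {y. lex_rank g y < \<nu>}"
      using \<nu> less_kernel_profile_iff[OF d s r(1)]
      by (auto simp: v_def r(2) not_less[symmetric] split: split_indicator_asm)
    then have "emeasure lborel {y. ennreal l < kernel_profile d s (lex_rank g y) * indicator E y} \<le>
        emeasure lborel ({y. lex_rank g y < v} - {y. lex_rank g y < \<nu>})"
      by (intro emeasure_mono) auto
    also have "\<dots> \<le> v - \<nu>"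
    proof (cases "\<nu> \<le> v")
      case True
      then have "\<nu> < \<infinity>" by (auto simp: v_def top_unique less_top[symmetric])
      have "emeasure lborel ({y. lex_rank g y < v} - {y. lex_rank g y < \<nu>}) =
          emeasure lborel {y. lex_rank g y < v} - emeasure lborel {y. lex_rank g y < \<nu>}"
        using True \<open>\<nu> < \<infinity>\<close> emeasure_lex_rank_less[OF g \<open>\<nu> < \<infinity>\<close>]
        by (intro emeasure_Diff) auto
      also have "\<dots> = v - \<nu>"
        using \<open>\<nu> < \<infinity>\<close> by (simp add: emeasure_lex_rank_less[OF g] v_def)
      finally show ?thesis by simp
    next
      case False
      then have "{y. lex_rank g y < v} - {y. lex_rank g y < \<nu>} = {}" by auto
      then show ?thesis by (simp only: emeasure_empty zero_le)
    qed
    finally show "emeasure lborel {y \<in> space lborel. ennreal l < kernel_profile d s (lex_rank g y) * indicator E y}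
        \<le> emeasure lborel {m \<in> space lborel. ennreal l <
          kernel_profile d s (ennreal m) * indicator {m. \<nu> \<le> ennreal m} m * indicator {0<..} m}"
      by (simp add: r(2) emeasure_kernel_profile_tail_superlevel[OF d s r(1)] v_def)
  qed auto
  then show ?thesis
    using False by (subst (asm) nn_integral_kernel_profile_tail[OF d s])
      (simp_all add: d_def zero_less_iff_neq_zero)
qed

text \<open>The ranking function \<open>g\<close> may differ from \<open>f\<close>: it suffices that
  volume at least \<open>\<nu> t\<close> is ranked before every point with
  \<open>t \<le> f y\<close>. This freedom serves to rank by a rounding of \<open>f\<close> when
  some sublevel set has finite measure, and by small pieces when none has.\<close>

lemma INF_admissible_kernel_le:
  fixes f g :: "real ^ 'n \<Rightarrow> real"
  assumes s: "0 < s" and g: "rankable g" and f [measurable]: "f \<in> borel_measurable borel"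
    and nonneg: "\<And>y. 0 \<le> f y"
    and [measurable]: "\<nu> \<in> borel_measurable borel"
    and \<nu>: "\<And>t y. 0 < t \<Longrightarrow> t \<le> f y \<Longrightarrow> \<nu> t \<le> emeasure lborel {z. g z < g y}"
  shows "(INF K\<in>{K. admissible_kernel s K}. \<integral>\<^sup>+y. ennreal (f y) * K y \<partial>lebesgue) \<le>
    ennreal (MA_constant (real CARD('n)) s) *
    (\<integral>\<^sup>+t\<in>{0<..}. inverse_ennpowr (\<nu> t) (s / real CARD('n)) \<partial>lborel)"
proof -
  let ?K = "\<lambda>y. kernel_profile (real CARD('n)) s (lex_rank g y)"
  let ?C = "ennreal (MA_constant (real CARD('n)) s)"
  have gb [measurable]: "g \<in> borel_measurable borel"
    using g by (auto simp: rankable_def)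
  then have [measurable]: "lex_rank g \<in> borel_measurable borel"
    by (rule borel_measurable_lex_rank)
  have rank: "\<nu> t \<le> lex_rank g y" if "0 < t" "t \<le> f y" for t y
  proof -
    have "emeasure lborel {z. g z < g y} \<le> lex_rank g y"
      unfolding lex_rank_def by (intro emeasure_mono) auto
    then show ?thesis
      using \<nu>[OF that] by simp
  qed
  have "(INF K\<in>{K. admissible_kernel s K}. \<integral>\<^sup>+y. ennreal (f y) * K y \<partial>lebesgue) \<le>
      (\<integral>\<^sup>+y. ennreal (f y) * ?K y \<partial>lebesgue)"
    by (rule INF_lower) (simp add: admissible_kernel_lex_rank[OF g s])
  also have "\<dots> = (\<integral>\<^sup>+y. ennreal (f y) * ?K y \<partial>lborel)"
    by (rule nn_integral_completion)
  also have "\<dots> = (\<integral>\<^sup>+t\<in>{0<..}. (\<integral>\<^sup>+y. ?K y * indicator {y. t \<le> f y} y \<partial>lborel) \<partial>lborel)"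
    by (rule nn_integral_layer_cake_weighted[OF sigma_finite_lborel]) (auto simp: nonneg)
  also have "\<dots> \<le> (\<integral>\<^sup>+t\<in>{0<..}. ?C * inverse_ennpowr (\<nu> t) (s / real CARD('n)) \<partial>lborel)"
  proof (intro nn_integral_mono)
    fix t :: real
    have "(\<integral>\<^sup>+y. ?K y * indicator {y. t \<le> f y} y \<partial>lborel) \<le>
        ?C * inverse_ennpowr (\<nu> t) (s / real CARD('n))" if "0 < t"
      using rank[OF that] by (intro nn_integral_lex_rank_kernel_le[OF g s]) auto
    then show "(\<integral>\<^sup>+y. ?K y * indicator {y. t \<le> f y} y \<partial>lborel) * indicator {0<..} t \<le>
        ?C * inverse_ennpowr (\<nu> t) (s / real CARD('n)) * indicator {0<..} t"
      by (auto split: split_indicator)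
  qed
  also have "\<dots> = ?C * (\<integral>\<^sup>+t\<in>{0<..}. inverse_ennpowr (\<nu> t) (s / real CARD('n)) \<partial>lborel)"
    by (subst nn_integral_cmult[symmetric]) (auto simp: mult.assoc)
  finally show ?thesis .
qed

section \<open>Upper bound when some sublevel set has finite measure\<close>

text \<open>After rounding, \<open>f y < q powr (k + 1)\<close> already forces
  \<open>g y \<le> q powr k\<close>, so no finite volume is skipped between consecutive powers. The
  price appears in the second claim: where \<open>f y\<close> is positive, only
  \<open>g y > f y / q\<close> is retained.\<close>

lemma rankable_geometric_rounding:
  fixes f :: "'a::euclidean_space \<Rightarrow> real"
  assumes f [measurable]: "f \<in> borel_measurable borel" and nonneg: "\<And>y. 0 \<le> f y"
    and q: "1 < q" and t0: "0 < t0" "emeasure lborel {y. f y < t0} < \<infinity>"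
  defines "g \<equiv> \<lambda>y. if f y = 0 then 0 else q powr real_of_int \<lfloor>log q (f y)\<rfloor>"
  shows "rankable g"
    and "\<And>t y. 0 < t \<Longrightarrow> t \<le> f y \<Longrightarrow>
      emeasure lborel {z. f z < t / q} \<le> emeasure lborel {z. g z < g y}"
proof -
  have less: "g y < q powr real_of_int k \<longleftrightarrow> f y < q powr real_of_int k" for y k
  proof (cases "f y = 0")
    case False
    then have "0 < f y" using nonneg[of y] by simp
    then show ?thesis
      using False q by (simp add: g_def floor_less_iff log_less_iff)
  qed (use q in \<open>simp add: g_def\<close>)
  have le: "f y < q powr real_of_int (k + 1) \<Longrightarrow> g y \<le> q powr real_of_int k" for y k
  proof (cases "f y = 0")
    case False
    assume *: "f y < q powr real_of_int (k + 1)"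
    have "0 < f y" using nonneg[of y] False by simp
    then have "\<lfloor>log q (f y)\<rfloor> < k + 1"
      using * q by (simp only: floor_less_iff log_less_iff)
    then show ?thesis
      using False q by (simp add: g_def)
  qed (use q in \<open>simp add: g_def\<close>)
  have g [measurable]: "g \<in> borel_measurable borel"
    unfolding g_def by measurable
  show "rankable g"
    unfolding rankable_def
  proof (intro conjI allI impI g)
    fix a :: ennreal assume a: "0 < a" "a < \<infinity>"
    define m where "m k = emeasure lborel {y. f y < q powr real_of_int k}" for k
    show "\<exists>\<gamma>. emeasure lborel {y. g y < \<gamma>} < a \<and> a \<le> emeasure lborel {y. g y \<le> \<gamma>}"
    proof (cases "a \<le> emeasure lborel {y. f y = 0}")
      case True
      have "{y. g y < 0} = {}"
        by (auto simp: g_def not_less)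
      moreover have "emeasure lborel {y. f y = 0} \<le> emeasure lborel {y. g y \<le> 0}"
        by (intro emeasure_mono) (auto simp: g_def)
      ultimately show ?thesis
        using a True by (intro exI[of _ 0]) auto
    next
      case False
      have "(\<lambda>n. q powr real_of_int (- int n)) \<longlonglongrightarrow> 0"
      proof -
        have "(\<lambda>n. (1 / q) ^ n) \<longlonglongrightarrow> 0"
          using q by (intro LIMSEQ_realpow_zero) auto
        moreover have "q powr real_of_int (- int n) = (1 / q) ^ n" for n
          using q by (simp add: powr_minus powr_realpow field_simps)
        ultimately show ?thesis by simp
      qed
      note lim = this
      then obtain N where N: "\<And>n. N \<le> n \<Longrightarrow> q powr real_of_int (- int n) < t0"
        using t0(1) by (metis (mono_tags, lifting) eventually_sequentially order_tendstoD(2))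
      \<comment> \<open>As the exponent tends to minus infinity, the volumes decrease to that of
        \<open>{y. f y = 0}\<close>, which is less than \<open>a\<close>; finiteness below
        \<open>t0\<close> justifies the limit.\<close>
      have "(INF n. m (- int (N + n))) = emeasure lborel (\<Inter>n. {y. f y < q powr real_of_int (- int (N + n))})"
        unfolding m_def
      proof (rule INF_emeasure_decseq)
        show "decseq (\<lambda>n. {y. f y < q powr real_of_int (- int (N + n))})"
          using q by (auto simp: decseq_def elim!: less_le_trans)
        fix n
        have "emeasure lborel {y. f y < q powr real_of_int (- int (N + n))} \<le> emeasure lborel {y. f y < t0}"
          using N[of "N + n"] by (intro emeasure_mono) auto
        then show "emeasure lborel {y. f y < q powr real_of_int (- int (N + n))} \<noteq> \<infinity>"
          using t0(2) by auto
      qed auto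
      also have "(\<Inter>n. {y. f y < q powr real_of_int (- int (N + n))}) = {y. f y = 0}"
      proof -
        have "f y = 0" if *: "\<forall>n. f y < q powr real_of_int (- int (N + n))" for y
        proof -
          have "(\<lambda>n. q powr real_of_int (- int (N + n))) \<longlonglongrightarrow> 0"
            using LIMSEQ_ignore_initial_segment[OF lim, of N] by (simp add: add.commute)
          then have "f y \<le> 0"
            by (rule LIMSEQ_le_const) (use * less_imp_le in blast)
          then show ?thesis using nonneg[of y] by simp
        qed
        then show ?thesis using q by auto
      qed
      finally have "(INF n. m (- int (N + n))) < a"
        using False by simp
      then obtain k0 where k0: "m k0 < a"
        by (auto simp: INF_less_iff)
      have "(SUP n. m (k0 + int n)) = emeasure lborel (\<Union>n. {y. f y < q powr real_of_int (k0 + int n)})"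
        unfolding m_def
      proof (rule SUP_emeasure_incseq)
        show "incseq (\<lambda>n. {y. f y < q powr real_of_int (k0 + int n)})"
          using q by (auto simp: incseq_def elim!: less_le_trans)
      qed auto
      also have "(\<Union>n. {y. f y < q powr real_of_int (k0 + int n)}) = UNIV"
      proof -
        have "\<exists>n. f y < q powr real_of_int (k0 + int n)" for y
        proof -
          obtain n where "f y / q powr real_of_int k0 < q ^ n"
            using real_arch_pow[OF q] by blast
          then have "f y < q powr real_of_int (k0 + int n)"
            using q by (simp add: powr_add powr_realpow field_simps)
          then show ?thesis ..
        qed
        then show ?thesis by auto
      qed
      finally have "a < (SUP n. m (k0 + int n))"
        using a by (simp only: emeasure_lborel_UNIV)
      then have ex: "\<exists>n. a \<le> m (k0 + int n)"
        by (auto simp: less_SUP_iff dest: less_imp_le)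
      \<comment> \<open>The first exponent at which the volume of \<open>{f < q powr _}\<close>
        reaches \<open>a\<close>. The level \<open>\<gamma>\<close> is one power lower, since
        rounding moves this whole set to values at most that power.\<close>
      define n where "n = (LEAST n. a \<le> m (k0 + int n))"
      have n: "a \<le> m (k0 + int n)"
        unfolding n_def using ex by (rule LeastI_ex)
      have "n \<noteq> 0"
        using n k0 by (intro notI) auto
      then obtain n' where n': "n = Suc n'"
        by (cases n) auto
      have "\<not> a \<le> m (k0 + int n')"
        using n' not_less_Least[of n' "\<lambda>n. a \<le> m (k0 + int n)"] by (simp add: n_def)
      then have "emeasure lborel {y. g y < q powr real_of_int (k0 + int n')} < a"
        unfolding less m_def by (simp only: not_le)
      moreover have "m (k0 + int n) \<le> emeasure lborel {y. g y \<le> q powr real_of_int (k0 + int n')}"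
        unfolding m_def using le[of _ "k0 + int n'"] by (intro emeasure_mono) (auto simp: n' ac_simps)
      ultimately show ?thesis
        using n by (intro exI[of _ "q powr real_of_int (k0 + int n')"]) auto
    qed
  qed
  fix t y assume t: "0 < t" "t \<le> f y"
  define k where "k = \<lfloor>log q (f y)\<rfloor>"
  have gy: "g y = q powr real_of_int k"
    using t by (simp add: g_def k_def)
  have "log q (f y) < real_of_int k + 1"
    unfolding k_def by linarith
  then have "f y < q powr (real_of_int k + 1)"
    using t q by (subst (asm) log_less_iff) auto
  then have "t / q < q powr real_of_int k"
    using t q by (simp add: powr_add field_simps)
  then have "{z. f z < t / q} \<subseteq> {z. g z < g y}"
    unfolding gy less by auto
  then show "emeasure lborel {z. f z < t / q} \<le> emeasure lborel {z. g z < g y}"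
    by (intro emeasure_mono) auto
qed

text \<open>Rounding evaluates the sublevel measures at \<open>t / q\<close>; the substitution of
  \<open>q * t\<close> for \<open>t\<close> produces the factor \<open>q\<close>, which then tends
  to 1.\<close>

lemma INF_admissible_kernel_le_finite:
  fixes f :: "real ^ 'n \<Rightarrow> real"
  assumes s: "0 < s" and f [measurable]: "f \<in> borel_measurable borel" and nonneg: "\<And>y. 0 \<le> f y"
    and t0: "0 < t0" "emeasure lborel {y. f y < t0} < \<infinity>"
  shows "(INF K\<in>{K. admissible_kernel s K}. \<integral>\<^sup>+y. ennreal (f y) * K y \<partial>lebesgue) \<le>
    ennreal (MA_constant (real CARD('n)) s) *
    (\<integral>\<^sup>+t\<in>{0<..}. inverse_ennpowr (emeasure lborel {y. f y < t}) (s / real CARD('n)) \<partial>lborel)"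
    (is "?L \<le> ?C * ?I")
proof -
  have mes [measurable]: "(\<lambda>t. emeasure lborel {y. f y < t}) \<in> borel_measurable borel"
    using f by (rule borel_measurable_sublevel_measure)
  have bound: "?L \<le> (?C * ?I) * ennreal q" if q: "1 < q" for q
  proof -
    let ?F = "\<lambda>t. inverse_ennpowr (emeasure lborel {y. f y < t}) (s / real CARD('n))"
    note g = rankable_geometric_rounding[OF f nonneg q t0]
    have mes_q: "(\<lambda>t. emeasure lborel {y. f y < t / q}) \<in> borel_measurable borel"
      using measurable_compose[OF _ mes, of "\<lambda>t. t / q" borel] by simp
    have "?L \<le> ?C * (\<integral>\<^sup>+t\<in>{0<..}. ?F (t / q) \<partial>lborel)"
      using INF_admissible_kernel_le[OF s g(1) f nonneg mes_q g(2)] .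
    also have "(\<integral>\<^sup>+t\<in>{0<..}. ?F (t / q) \<partial>lborel) =
        ennreal \<bar>q\<bar> * (\<integral>\<^sup>+t. ?F ((0 + q * t) / q) * indicator {0<..} (0 + q * t) \<partial>lborel)"
      using mes_q q by (intro nn_integral_real_affine) auto
    also have "(\<integral>\<^sup>+t. ?F ((0 + q * t) / q) * indicator {0<..} (0 + q * t) \<partial>lborel) = ?I"
      using q by (intro nn_integral_cong) (auto simp: zero_less_mult_iff split: split_indicator)
    finally show ?thesis
      using q by (simp add: ac_simps)
  qed
  show ?thesis
  proof (cases "?C * ?I = \<infinity>")
    case False
    have "(\<lambda>n. (?C * ?I) * ennreal (1 + inverse (real (Suc n)))) \<longlonglongrightarrow> (?C * ?I) * ennreal (1 + 0)"
      using False
      by (intro ennreal_tendsto_cmult tendsto_ennrealI tendsto_add tendsto_const LIMSEQ_inverse_real_of_nat)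
        (auto simp: less_top)
    then have "?L \<le> (?C * ?I) * ennreal (1 + 0)"
      by (rule LIMSEQ_le_const) (intro exI allI impI bound, simp)
    then show ?thesis by simp
  qed simp
qed

section \<open>Upper bound when all sublevel sets have infinite measure\<close>

lemma term_le_suminf: "a k \<le> (\<Sum>k. a k)" for a :: "nat \<Rightarrow> ennreal"
  using sum_le_suminf[of a "{k}"] by simp

text \<open>If all sublevel sets are infinite, place pieces \<open>G k\<close> of volume \<open>2\<^sup>-\<^sup>k\<close> inside \<open>{f < \<delta> k}\<close> and let
  the kernel fill the smaller pieces first; \<open>\<delta> k\<close> is so small that its singularity costs at most
  \<open>\<epsilon>\<close>.\<close>

lemma INF_admissible_kernel_le_infinite:
  fixes f :: "real ^ 'n \<Rightarrow> real"
  assumes s: "0 < s" and f [measurable]: "f \<in> borel_measurable borel" and nonneg: "\<And>y. 0 \<le> f y"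
    and inf: "\<And>t. 0 < t \<Longrightarrow> emeasure lborel {y. f y < t} = \<infinity>" and \<epsilon>: "0 < \<epsilon>"
  shows "(INF K\<in>{K. admissible_kernel s K}. \<integral>\<^sup>+y. ennreal (f y) * K y \<partial>lebesgue) \<le>
    ennreal (MA_constant (real CARD('n)) s) * ennreal \<epsilon>"
proof -
  define p where "p = s / real CARD('n)"
  have p: "0 < p" using s by (simp add: p_def)
  \<comment> \<open>The last factor cancels \<open>((1 / 2) ^ Suc k) powr (- p)\<close>, the value
    of \<open>inverse_ennpowr\<close> at the volume of \<open>G (Suc k)\<close>. What remains is
    \<open>\<epsilon> / 2 * (1 / 2) ^ k\<close>, which sums to \<open>\<epsilon>\<close>.\<close>
  define \<delta> where "\<delta> k = \<epsilon> / 2 * (1 / 2) ^ k * ((1 / 2) ^ Suc k) powr p" for k :: nat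
  have \<delta>_pos: "0 < \<delta> k" for k
    using \<epsilon> by (simp add: \<delta>_def)
  have \<delta>_Suc: "\<delta> (Suc k) < \<delta> k" for k
  proof -
    have "((1 / 2) ^ Suc (Suc k)) powr p < ((1 / 2) ^ Suc k :: real) powr p"
      using p by (intro powr_less_mono2) auto
    then have "(1 / 2) ^ Suc k * ((1 / 2) ^ Suc (Suc k)) powr p < (1 / 2) ^ k * ((1 / 2) ^ Suc k :: real) powr p"
      by (intro mult_strict_mono) auto
    then show ?thesis
      using \<epsilon> by (simp only: \<delta>_def mult.assoc) simp
  qed
  then have \<delta>_less_iff: "\<delta> j < \<delta> k \<longleftrightarrow> k < j" for j k
    using strict_mono_less[of "\<lambda>k. - \<delta> k" k j] by (simp add: strict_mono_Suc_iff)
  then have \<delta>_le_iff: "\<delta> j \<le> \<delta> k \<longleftrightarrow> k \<le> j" for j k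
    by (metis not_le)
  have \<delta>_le: "\<delta> k \<le> \<epsilon> / 2 * (1 / 2) ^ k" for k
  proof -
    have "((1 / 2) ^ Suc k :: real) powr p \<le> 1"
      using p power_le_one[of "1 / 2 :: real" "Suc k"] by (intro powr_le1) (auto simp del: power_Suc)
    then show ?thesis
      using \<epsilon> unfolding \<delta>_def by (intro mult_left_le) auto
  qed
  have "(\<lambda>k. \<epsilon> / 2 * (1 / 2) ^ k) \<longlonglongrightarrow> \<epsilon> / 2 * 0"
    by (intro tendsto_mult_left LIMSEQ_realpow_zero) auto
  then have \<delta>_lim: "\<delta> \<longlonglongrightarrow> 0"
    by (intro tendsto_sandwich[of "\<lambda>_. 0" \<delta> _ "\<lambda>k. \<epsilon> / 2 * (1 / 2) ^ k"])
      (use \<delta>_le \<delta>_pos in \<open>auto intro!: always_eventually less_imp_le\<close>)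

  define D where "D k = {y. f y < \<delta> k}" for k
  have D [measurable]: "D k \<in> sets borel" for k
    unfolding D_def by measurable
  have D_inf: "emeasure lborel (D k) = \<infinity>" for k
    unfolding D_def by (intro inf \<delta>_pos)
  \<comment> \<open>\<open>G 0\<close> keeps its infinite volume, so that every finite volume is
    reached by the ranking.\<close>
  define G where "G k = (if k = 0 then D 0
    else {y\<in>D k. emeasure lborel (D k \<inter> ball 0 (norm y)) < ennreal ((1 / 2) ^ k)})" for k
  have G [measurable]: "G k \<in> sets borel" for k
    unfolding G_def using sets_borel_initial_part[OF D] by auto
  have G_D: "G k \<subseteq> D k" for k
    by (auto simp: G_def)
  have D_0: "D k \<subseteq> D 0" for k
    using \<delta>_le_iff[of k 0] by (auto simp: D_def)
  have G_0: "G 0 = D 0" by (simp add: G_def)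
  have G_Suc: "emeasure lborel (G (Suc k)) = ennreal ((1 / 2) ^ Suc k)" for k
    unfolding G_def using D_inf by (simp del: power_Suc, intro emeasure_initial_part) auto
  \<comment> \<open>\<open>g\<close> is the infimum of \<open>\<delta> k\<close> over the pieces
    containing the point, so pieces of larger index come first; points in no piece get a value above
    every \<open>\<delta> k\<close>.\<close>
  define h where "h k y = (if y \<in> G k then \<delta> k else \<delta> 0 + 1)" for k y
  define g where "g y = (INF k. h k y)" for y
  have bdd: "bdd_below (range (\<lambda>k. h k y))" for y
    using \<delta>_pos by (intro bdd_belowI[of _ 0]) (auto simp: h_def less_imp_le add_nonneg_nonneg)
  have g [measurable]: "g \<in> borel_measurable borel"
    unfolding g_def[abs_def] h_def[abs_def] by measurable
  have g_less: "{y. g y < c} = (\<Union>k\<in>{k. \<delta> k < c}. G k)" if "c \<le> \<delta> 0 + 1" for c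
  proof -
    have "g y < c \<longleftrightarrow> (\<exists>k. h k y < c)" for y
      unfolding g_def by (subst cINF_less_iff[OF _ bdd]) auto
    then show ?thesis
      using that by (auto simp: h_def split: if_splits)
  qed
  have g_le: "g y \<le> \<delta> k" if "y \<in> G k" for y k
    using cINF_lower[OF bdd, of k y] that by (simp add: g_def h_def)
  have less_\<delta>: "{y. g y < \<delta> k} = (\<Union>j\<in>{k<..}. G j)" for k
    using \<delta>_le_iff[of k 0] by (subst g_less) (auto simp: \<delta>_less_iff)
  have small: "emeasure lborel {y. g y < \<delta> k} \<le> ennreal ((1 / 2) ^ k)" for k
  proof -
    have "{k<..} = range (\<lambda>j. Suc (k + j))"
      by (auto simp: less_iff_Suc_add image_iff)
    then have "emeasure lborel {y. g y < \<delta> k} \<le> (\<Sum>j. emeasure lborel (G (Suc (k + j))))"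
      unfolding less_\<delta> by (simp, intro emeasure_subadditive_countably) auto
    also have "\<dots> = (\<Sum>j. ennreal ((1 / 2) ^ Suc k * (1 / 2) ^ j))"
      unfolding G_Suc by (simp add: power_add)
    also have "\<dots> = ennreal ((1 / 2) ^ Suc k * (1 / (1 - 1 / 2)))"
      by (intro suminf_ennreal_eq sums_mult geometric_sums) auto
    finally show ?thesis by simp
  qed
  have rank: "rankable g"
    unfolding rankable_def
  proof (intro conjI allI impI g)
    fix a :: ennreal assume a: "0 < a" "a < \<infinity>"
    have "(\<lambda>k. ennreal ((1 / 2) ^ k)) \<longlonglongrightarrow> ennreal 0"
      by (intro tendsto_ennrealI LIMSEQ_realpow_zero) auto
    then have "eventually (\<lambda>k. ennreal ((1 / 2) ^ k) < a) sequentially"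
      using a(1) by (intro order_tendstoD) auto
    then obtain k0 where "ennreal ((1 / 2) ^ k0) < a"
      by (auto simp: eventually_sequentially)
    then have ex: "\<exists>k. emeasure lborel {y. g y < \<delta> k} < a"
      using small le_less_trans by blast
    \<comment> \<open>The level is \<open>\<delta> k\<close>. If \<open>k = 0\<close>,
      \<open>{g \<le> \<delta> 0}\<close> contains the infinite \<open>G 0\<close>; otherwise
      minimality applies to the preceding index, and \<open>g\<close> has no value strictly between
      \<open>\<delta> k\<close> and its predecessor.\<close>
    define k where "k = (LEAST k. emeasure lborel {y. g y < \<delta> k} < a)"
    have k: "emeasure lborel {y. g y < \<delta> k} < a"
      unfolding k_def using ex by (rule LeastI_ex)
    have "a \<le> emeasure lborel {y. g y \<le> \<delta> k}"
    proof (cases k)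
      case 0
      have "emeasure lborel (G 0) \<le> emeasure lborel {y. g y \<le> \<delta> k}"
        unfolding 0 using g_le by (intro emeasure_mono) auto
      then show ?thesis
        by (simp add: G_0 D_inf top_unique)
    next
      case (Suc k')
      have "a \<le> emeasure lborel {y. g y < \<delta> k'}"
        using not_less_Least[of k' "\<lambda>k. emeasure lborel {y. g y < \<delta> k} < a"] Suc by (simp add: k_def)
      also have "\<dots> \<le> emeasure lborel {y. g y \<le> \<delta> k}"
      proof (intro emeasure_mono)
        show "{y. g y < \<delta> k'} \<subseteq> {y. g y \<le> \<delta> k}"
          unfolding less_\<delta>
        proof clarify
          fix y j assume "k' < j" "y \<in> G j"
          then show "g y \<le> \<delta> k"
            using g_le[of y j] \<delta>_le_iff[of j k] Suc by simp
        qed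
      qed simp
      finally show ?thesis .
    qed
    with k show "\<exists>\<gamma>. emeasure lborel {y. g y < \<gamma>} < a \<and> a \<le> emeasure lborel {y. g y \<le> \<gamma>}"
      by blast
  qed
  \<comment> \<open>Outside \<open>D 0\<close> all of \<open>G 0\<close> is ranked earlier, so
    \<open>\<infinity>\<close> is a valid bound for \<open>t > \<delta> 0\<close> and the integrand
    vanishes there. On \<open>D 0\<close> the inequality \<open>f \<le> g\<close> gives the bound
    for smaller \<open>t\<close>.\<close>
  define \<nu> where "\<nu> t = (if t \<le> \<delta> 0 then emeasure lborel {y. g y < t} else \<infinity>)" for t
  have [measurable]: "\<nu> \<in> borel_measurable borel"
    using borel_measurable_sublevel_measure[OF g] unfolding \<nu>_def[abs_def] by measurable
  have \<nu>: "\<nu> t \<le> emeasure lborel {z. g z < g y}" if "0 < t" "t \<le> f y" for t y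
  proof (cases "y \<in> D 0")
    case True
    have "f y \<le> h k y" for k
      using True G_D by (auto simp: h_def D_def intro: less_imp_le)
    then have "f y \<le> g y"
      unfolding g_def by (intro cINF_greatest) auto
    then have "emeasure lborel {z. g z < t} \<le> emeasure lborel {z. g z < g y}"
      using that by (intro emeasure_mono) auto
    then show ?thesis
      using True that by (auto simp: \<nu>_def D_def)
  next
    case False
    then have "h k y = \<delta> 0 + 1" for k
      using G_D[of k] D_0[of k] by (auto simp: h_def)
    then have "g y = \<delta> 0 + 1"
      by (simp add: g_def)
    then have "emeasure lborel (G 0) \<le> emeasure lborel {z. g z < g y}"
      using g_le[of _ 0] by (intro emeasure_mono) fastforce+
    then show ?thesis
      by (simp add: G_0 D_inf top_unique)
  qed
  let ?w = "\<lambda>k. ((1 / 2) ^ Suc k) powr (- p) :: real"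
  have "(INF K\<in>{K. admissible_kernel s K}. \<integral>\<^sup>+y. ennreal (f y) * K y \<partial>lebesgue) \<le>
      ennreal (MA_constant (real CARD('n)) s) * (\<integral>\<^sup>+t\<in>{0<..}. inverse_ennpowr (\<nu> t) p \<partial>lborel)"
    unfolding p_def by (rule INF_admissible_kernel_le[OF s rank f nonneg _ \<nu>]) auto
  also have "(\<integral>\<^sup>+t\<in>{0<..}. inverse_ennpowr (\<nu> t) p \<partial>lborel) \<le>
      (\<integral>\<^sup>+t. (\<Sum>k. ennreal (?w k) * indicator {0<..\<delta> k} t) \<partial>lborel)"
  proof (intro nn_integral_mono)
    fix t :: real
    have "inverse_ennpowr (\<nu> t) p \<le> (\<Sum>k. ennreal (?w k) * indicator {0<..\<delta> k} t)"
      if "0 < t" "t \<le> \<delta> 0"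
    proof -
      have "\<exists>k. \<delta> k < t"
        using order_tendstoD(2)[OF \<delta>_lim \<open>0 < t\<close>] by (auto simp: eventually_sequentially)
      \<comment> \<open>With \<open>n = Suc k\<close> this locates \<open>t\<close> between
        \<open>\<delta> (Suc k)\<close> and \<open>\<delta> k\<close>. Then \<open>G (Suc k)\<close>
        lies in \<open>{g < t}\<close>, and the \<open>k\<close>-th term of the series alone
        dominates the integrand.\<close>
      define n where "n = (LEAST k. \<delta> k < t)"
      have n: "\<delta> n < t"
        unfolding n_def using \<open>\<exists>k. \<delta> k < t\<close> by (rule LeastI_ex)
      then have "n \<noteq> 0"
        using that by (intro notI) auto
      then obtain k where k: "n = Suc k"
        by (cases n) auto
      have "t \<le> \<delta> k"
        using not_less_Least[of k "\<lambda>k. \<delta> k < t"] k by (simp add: n_def)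
      have "emeasure lborel (G (Suc k)) \<le> \<nu> t"
        using that n g_le[of _ n] unfolding \<nu>_def k
        by (auto intro!: emeasure_mono intro: le_less_trans)
      then have "inverse_ennpowr (\<nu> t) p \<le> inverse_ennpowr (ennreal ((1 / 2) ^ Suc k)) p"
        using p unfolding G_Suc by (intro inverse_ennpowr_antimono)
      also have "\<dots> = ennreal (?w k) * indicator {0<..\<delta> k} t"
        using that \<open>t \<le> \<delta> k\<close> by (subst inverse_ennpowr_ennreal) auto
      also have "\<dots> \<le> (\<Sum>k. ennreal (?w k) * indicator {0<..\<delta> k} t)"
        by (rule term_le_suminf)
      finally show ?thesis .
    qed
    then show "inverse_ennpowr (\<nu> t) p * indicator {0<..} t \<le> (\<Sum>k. ennreal (?w k) * indicator {0<..\<delta> k} t)"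
      by (cases "t \<le> \<delta> 0") (auto simp: \<nu>_def split: split_indicator)
  qed
  also have "\<dots> = (\<Sum>k. ennreal (?w k) * ennreal (\<delta> k))"
    using \<delta>_pos by (subst nn_integral_suminf) (auto simp: nn_integral_cmult_indicator less_imp_le)
  also have "\<dots> = (\<Sum>k. ennreal (\<epsilon> / 2 * (1 / 2) ^ k))"
  proof (intro arg_cong[of _ _ suminf] ext)
    fix k
    have "?w k * \<delta> k = \<epsilon> / 2 * (1 / 2) ^ k"
      unfolding \<delta>_def powr_minus by (simp add: field_simps)
    then show "ennreal (?w k) * ennreal (\<delta> k) = ennreal (\<epsilon> / 2 * (1 / 2) ^ k)"
      using \<delta>_pos[of k] by (simp only: ennreal_mult[symmetric] less_imp_le powr_ge_zero)
  qed
  also have "\<dots> = ennreal (\<epsilon> / 2 * (1 / (1 - 1 / 2)))"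
    using \<epsilon> by (intro suminf_ennreal_eq sums_mult geometric_sums) auto
  finally show ?thesis
    by (simp add: mult_left_mono)
qed

section \<open>The infimum for one subgradient and the final supremum\<close>

text \<open>For the upper bound, either some sublevel set at a positive level has finite measure and
  rounded ranks apply, or the infimum is at most every positive multiple of the constant and hence
  zero.\<close>

lemma INF_admissible_kernel_eq:
  fixes f :: "real ^ 'n \<Rightarrow> real"
  assumes s: "0 < s" and f: "continuous_on UNIV f" and nonneg: "\<And>y. 0 \<le> f y" and zero: "f 0 = 0"
  shows "(INF K\<in>{K. admissible_kernel s K}. \<integral>\<^sup>+y. ennreal (f y) * K y \<partial>lebesgue) =
    ennreal (MA_constant (real CARD('n)) s) *
    (\<integral>\<^sup>+t\<in>{0<..}. inverse_ennpowr (emeasure lebesgue {y. f y < t}) (s / real CARD('n)) \<partial>lborel)"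
    (is "?L = ?C * ?I")
proof (rule antisym)
  have fb [measurable]: "f \<in> borel_measurable borel"
    using f by (rule borel_measurable_continuous_onI)
  show "?C * ?I \<le> ?L"
  proof (intro INF_greatest)
    fix K assume "K \<in> {K :: real ^ 'n \<Rightarrow> ennreal. admissible_kernel s K}"
    then show "?C * ?I \<le> (\<integral>\<^sup>+y. ennreal (f y) * K y \<partial>lebesgue)"
      by (intro admissible_kernel_lower_bound[OF s _ f nonneg zero]) simp
  qed
  show "?L \<le> ?C * ?I"
  proof (cases "\<exists>t>0. emeasure lborel {y. f y < t} < \<infinity>")
    case True
    then show ?thesis
      using INF_admissible_kernel_le_finite[OF s fb nonneg] by auto
  next
    case False
    then have "?L \<le> ?C * ennreal (inverse (real (Suc n)))" for n
      by (intro INF_admissible_kernel_le_infinite[OF s fb nonneg])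
        (auto simp: not_less top_unique simp flip: not_le)
    moreover have "(\<lambda>n. ?C * ennreal (inverse (real (Suc n)))) \<longlonglongrightarrow> ?C * ennreal 0"
      by (intro ennreal_tendsto_cmult tendsto_ennrealI LIMSEQ_inverse_real_of_nat) auto
    ultimately have "?L \<le> ?C * ennreal 0"
      by (intro LIMSEQ_le_const) auto
    then show ?thesis by simp
  qed
qed

lemma sublevel_measure_eq:
  fixes u :: "real ^ 'n \<Rightarrow> real"
  assumes "u \<in> borel_measurable borel"
  shows "sublevel_measure u x b t = emeasure lebesgue {y. u (x + y) - u x - y \<bullet> b < t}"
proof -
  note [measurable] = assms
  have "sublevel_measure u x b t = emeasure (distr lborel borel ((+) x)) {y. u y - u x - b \<bullet> (y - x) < t}"
    unfolding sublevel_measure_def lborel_distr_plus by simp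
  also have "\<dots> = emeasure lborel {y. u (x + y) - u x - y \<bullet> b < t}"
    by (subst emeasure_distr) (auto simp: vimage_def inner_commute)
  finally show ?thesis by simp
qed

theorem proposition3p8:
  fixes s :: real
  assumes "1 < s" and "s < 2"
  shows "\<exists>C :: real. \<forall>(u :: real ^ 'n \<Rightarrow> real) x.
    continuous_on UNIV u \<longrightarrow> strictly_convex_at u x \<longrightarrow>
      MA s u x =
        ereal C * enn2ereal (SUP b\<in>subdiff u x.
          \<integral>\<^sup>+t\<in>{0<..}. inverse_ennpowr (sublevel_measure u x b t) (s / real CARD('n)) \<partial>lborel)"
proof (intro exI allI impI)
  fix u :: "real ^ 'n \<Rightarrow> real" and x
  assume u: "continuous_on UNIV u" and convex: "strictly_convex_at u x"
  have ub: "u \<in> borel_measurable borel"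
    using u by (rule borel_measurable_continuous_onI)
  \<comment> \<open>The existential witness, left open by \<open>exI\<close>, is instantiated in the
    final \<open>show\<close>; it involves only the dimension and \<open>s\<close>.\<close>
  define C where "C = MA_constant (real CARD('n)) s"
  let ?I = "\<lambda>b. \<integral>\<^sup>+t\<in>{0<..}. inverse_ennpowr (sublevel_measure u x b t) (s / real CARD('n)) \<partial>lborel"
  obtain p c where pc: "\<And>z. p \<bullet> z + c \<le> u z" "{z. u z = p \<bullet> z + c} = {x}"
    using convex by (auto simp: strictly_convex_at_def)
  \<comment> \<open>The slope of the touching plane is a subgradient, which rules out the value
    \<open>- \<infinity>\<close> in \<open>MA\<close>.\<close>
  have "u x = p \<bullet> x + c"
    using pc(2) by blast
  then have "p \<in> subdiff u x"
    using pc(1) by (auto simp: subdiff_def inner_diff_right algebra_simps)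
  then have nonempty: "subdiff u x \<noteq> {}" by blast
  have "(INF K\<in>{K. admissible_kernel s K}.
      \<integral>\<^sup>+y. ennreal (u (x + y) - u x - y \<bullet> b) * K y \<partial>lebesgue) = ennreal C * ?I b"
    if "b \<in> subdiff u x" for b
    unfolding sublevel_measure_eq[OF ub] C_def
  proof (rule INF_admissible_kernel_eq)
    show "continuous_on UNIV (\<lambda>y. u (x + y) - u x - y \<bullet> b)"
      by (intro continuous_intros continuous_on_compose2[OF u]) auto
    show "0 \<le> u (x + y) - u x - y \<bullet> b" for y
    proof -
      have "u (x + y) \<ge> u x + b \<bullet> (x + y - x)"
        using that unfolding subdiff_def by blast
      then show ?thesis by (simp add: inner_commute)
    qed
  qed (use assms in auto)
  then have "MA s u x = enn2ereal (ennreal C * (SUP b\<in>subdiff u x. ?I b))"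
    using nonempty by (simp add: MA_def SUP_mult_left_ennreal)
  \<comment> \<open>Positivity of the constant makes \<open>ennreal C\<close> and
    \<open>ereal C\<close> agree under the embedding.\<close>
  also have "\<dots> = ereal C * enn2ereal (SUP b\<in>subdiff u x. ?I b)"
    using MA_constant_pos[of "real CARD('n)" s] assms
    by (simp add: times_ennreal.rep_eq C_def enn2ereal_ennreal less_imp_le)
  finally show "MA s u x = ereal (MA_constant (real CARD('n)) s) * enn2ereal (SUP b\<in>subdiff u x. ?I b)"
    by (simp add: C_def)
qed

end
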